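(* Let $G$ be a graph, let $k\ge 1$ be an integer, and let $j$ be an integer with $\mathsf{s}_j(G) > j \geq \gamma_P(G)$. Let $q$ and $r$ be the non-negative integers (given by the division algorithm) with $k+1=q(\mathsf{s}_j(G)-j+1)+r$ and $0\le r<\mathsf{s}_j(G)-j+1$. Then \[ \ddot{\gamma}_P^k(G) \leq \begin{cases} \mathsf{s}_j(G)\left(\frac{k+1}{\mathsf{s}_j(G)-j+1}\right) & \text{if } r=0,\\[4pt] \mathsf{s}_j(G)\left\lfloor \frac{k+1}{\mathsf{s}_j(G)-j+1}\right\rfloor + r+(j-1) & \text{if } r>0. \end{cases} \]
   Context: All graphs are finite, simple, undirected, with nonempty vertex set. For $S\subseteq V(G)$ the power domination process is: (1) start with the observed set $N[S]$ (the union of closed neighborhoods of vertices of $S$); (2) while some observed vertex has exactly one unobserved neighbor $w$, add $w$ to the observed set. $S$ is a power dominating set if eventually all vertices are observed. $\gamma_P(G)$ is the minimum cardinality of a power dominating set. For an integer $k\ge 0$, a multiset $S$ of vertices of $G$ (its elements are called PMUs) is a $k$-PMU-defect-robust power dominating set ($k$-rPDS) if $|S|\ge k$ and for every submultiset $F$ of $S$ with $|F|=k$, the underlying set of $S\setminus F$ (multiset difference) contains a power dominating set of $G$. Cardinalities of multisets count multiplicity. $\ddot{\gamma}_P^k(G)$ is the minimum cardinality of a $k$-rPDS of $G$. For an integer $j\ge\gamma_P(G)$, $\mathsf{s}_j(G)$ is the maximum cardinality of a set $B\subseteq V(G)$ such that every $A\subseteq B$ with $|A|=j$ is a power dominating set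 of $G$ (undefined if no such $B$ exists). *)

theory Defs
  imports Complex_Main "HOL-Library.Multiset" "Graph_Theory.Digraph"
begin

(* Undirected graphs are symmetric digraphs: the locale predicate "graph G" says that G is finite,
   loop-free, without parallel arcs, and symmetric.  Each edge uv is the pair of arcs u -> v, v -> u.
   The null graph is not excluded by that predicate. *)

definition neighborhood :: "('a, 'b) pre_digraph \<Rightarrow> 'a \<Rightarrow> 'a set" where
  "neighborhood G v = {w. v \<rightarrow>\<^bsub>G\<^esub> w}"

definition closed_neighborhood :: "('a, 'b) pre_digraph \<Rightarrow> 'a set \<Rightarrow> 'a set" where
  "closed_neighborhood G S = (\<Union>v\<in>S. insert v (neighborhood G v))"

(* power_state G S X: X is the observed set at some stage of a run of the process started from S. *)
inductive power_state :: "('a, 'b) pre_digraph \<Rightarrow> 'a set \<Rightarrow> 'a set \<Rightarrow> bool"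
  for G :: "('a, 'b) pre_digraph" and S :: "'a set" where
  domination: "power_state G S (closed_neighborhood G S)"
| forcing: "power_state G S X \<Longrightarrow> v \<in> X \<Longrightarrow> neighborhood G v - X = {w} \<Longrightarrow>
    power_state G S (insert w X)"

(* By power_state_confluent below, it does not matter which run is chosen. *)
definition power_dominating :: "('a, 'b) pre_digraph \<Rightarrow> 'a set \<Rightarrow> bool" where
  "power_dominating G S \<longleftrightarrow> S \<subseteq> verts G \<and> power_state G S (verts G)"

definition power_domination_number :: "('a, 'b) pre_digraph \<Rightarrow> nat" where
  "power_domination_number G = (LEAST n. \<exists>S. power_dominating G S \<and> card S = n)"

definition robust_power_dominating ::
    "('a, 'b) pre_digraph \<Rightarrow> nat \<Rightarrow> 'a multiset \<Rightarrow> bool" where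
  "robust_power_dominating G k S \<longleftrightarrow>
     set_mset S \<subseteq> verts G \<and> size S \<ge> k \<and>
     (\<forall>F. F \<subseteq># S \<and> size F = k \<longrightarrow> (\<exists>D. D \<subseteq> set_mset (S - F) \<and> power_dominating G D))"

definition robust_power_domination_number :: "('a, 'b) pre_digraph \<Rightarrow> nat \<Rightarrow> nat" where
  "robust_power_domination_number G k =
     (LEAST n. \<exists>S. robust_power_dominating G k S \<and> size S = n)"

definition all_subsets_dominating :: "('a, 'b) pre_digraph \<Rightarrow> nat \<Rightarrow> 'a set \<Rightarrow> bool" where
  "all_subsets_dominating G j B \<longleftrightarrow>
     B \<subseteq> verts G \<and> (\<forall>A. A \<subseteq> B \<and> card A = j \<longrightarrow> power_dominating G A)"

(* For j > 0 the maximum is over a nonempty set, since B = {} qualifies vacuously; see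
   all_subsets_dominating_number_max. *)
definition all_subsets_dominating_number :: "('a, 'b) pre_digraph \<Rightarrow> nat \<Rightarrow> nat" where
  "all_subsets_dominating_number G j = Max {card B | B. all_subsets_dominating G j B}"


lemma power_state_subset_stalled:
  assumes "power_state G S Y"
    and "closed_neighborhood G S \<subseteq> X"
    and "\<And>v w. v \<in> X \<Longrightarrow> neighborhood G v - X \<noteq> {w}"
  shows "Y \<subseteq> X"
  using assms(1)
proof induction
  case domination
  show ?case by (rule assms(2))
next
  case (forcing Y v w)
  have "w \<in> X"
  proof (rule ccontr)
    assume "w \<notin> X"
    with forcing have "neighborhood G v - X = {w}" by blast
    with assms(3)[of v w] forcing show False by blast
  qed
  with forcing show ?case by simp
qed

lemma power_state_confluent:
  assumes "power_state G S X" "\<And>v w. v \<in> X \<Longrightarrow> neighborhood G v - X \<noteq> {w}"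
    and "power_state G S Y" "\<And>v w. v \<in> Y \<Longrightarrow> neighborhood G v - Y \<noteq> {w}"
  shows "X = Y"
proof -
  have *: "closed_neighborhood G S \<subseteq> Z" if "power_state G S Z" for Z
    using that by induction auto
  show ?thesis
    using power_state_subset_stalled[OF assms(1) *[OF assms(3)] assms(4)]
      power_state_subset_stalled[OF assms(3) *[OF assms(1)] assms(2)] by blast
qed

lemma power_dominating_verts:
  assumes "graph G"
  shows "power_dominating G (verts G)"
proof -
  interpret graph G by fact
  have "closed_neighborhood G (verts G) = verts G"
    unfolding closed_neighborhood_def neighborhood_def by (auto dest: adj_in_verts)
  then show ?thesis
    unfolding power_dominating_def using power_state.domination[of G "verts G"] by simp
qed

lemma power_domination_number_min:
  assumes "graph G"
  obtains S where "power_dominating G S" "card S = power_domination_number G"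
  unfolding power_domination_number_def
  using LeastI[of "\<lambda>n. \<exists>S. power_dominating G S \<and> card S = n"] power_dominating_verts[OF assms]
  by blast

lemma not_power_dominating_empty:
  assumes "verts G \<noteq> {}"
  shows "\<not> power_dominating G {}"
proof -
  have "X = {}" if "power_state G {} X" for X
    using that by induction (auto simp: closed_neighborhood_def)
  with assms show ?thesis unfolding power_dominating_def by blast
qed

lemma power_domination_number_pos:
  assumes "graph G" "verts G \<noteq> {}"
  shows "power_domination_number G > 0"
proof -
  interpret graph G by fact
  obtain S where S: "power_dominating G S" "card S = power_domination_number G"
    using power_domination_number_min[OF assms(1)] .
  then have "finite S" "S \<noteq> {}"
    using not_power_dominating_empty[OF assms(2)] finite_subset[OF _ finite_verts]
    unfolding power_dominating_def by auto
  then show ?thesis using S(2) by (metis card_gt_0_iff)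
qed

lemma all_subsets_dominating_number_max:
  assumes "graph G" "j > 0"
  obtains B where "all_subsets_dominating G j B" "card B = all_subsets_dominating_number G j"
    "\<And>C. all_subsets_dominating G j C \<Longrightarrow> card C \<le> all_subsets_dominating_number G j"
proof -
  interpret graph G by fact
  let ?M = "{card B | B. all_subsets_dominating G j B}"
  have "?M \<subseteq> {..card (verts G)}"
    unfolding all_subsets_dominating_def by (auto intro: card_mono)
  then have fin: "finite ?M" by (rule finite_subset) simp
  have "all_subsets_dominating G j {}"
    using assms(2) unfolding all_subsets_dominating_def by auto
  then have "?M \<noteq> {}" by blast
  with fin have "Max ?M \<in> ?M" by (rule Max_in)
  then obtain B where "all_subsets_dominating G j B" "card B = Max ?M" by auto
  moreover have "card C \<le> Max ?M" if "all_subsets_dominating G j C" for C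
    using that by (intro Max_ge[OF fin]) blast
  ultimately show ?thesis
    using that[of B] unfolding all_subsets_dominating_number_def by simp
qed

lemma robust_power_domination_number_min:
  assumes "graph G" "verts G \<noteq> {}"
  obtains S where "robust_power_dominating G k S" "size S = robust_power_domination_number G k"
proof -
  interpret graph G by fact
  define S where "S = repeat_mset (k + 1) (mset_set (verts G))"
  have count: "count S v = k + 1" if "v \<in> verts G" for v
    using that by (simp add: S_def)
  have "card (verts G) > 0" using assms(2) by (simp add: card_gt_0_iff)
  then have "k \<le> (k + 1) * card (verts G)"
    by (cases "card (verts G)") auto
  then have size: "k \<le> size S" by (simp add: S_def)
  have "verts G \<subseteq> set_mset (S - F)" if "size F = k" for F
  proof
    fix v assume "v \<in> verts G"
    then have "count F v < count S v"
      using count_le_size[of F v] that by (simp add: count)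
    then show "v \<in># S - F" by (simp add: in_diff_count)
  qed
  moreover have "set_mset S = verts G" 
    by (auto simp: S_def simp flip: count_greater_zero_iff)
      (simp_all add: count_mset_set' split: if_splits)
  ultimately have "robust_power_dominating G k S"
    using size power_dominating_verts[OF assms(1)]
    unfolding robust_power_dominating_def by blast
  then show ?thesis
    using that LeastI[of "\<lambda>n. \<exists>S. robust_power_dominating G k S \<and> size S = n"]
    unfolding robust_power_domination_number_def by blast
qed

end

theory Submission
  imports Defs
begin

text \<open>
  Let \<open>B\<close> realise the maximum in the definition of \<open>s\<close>. Place \<open>q\<close> PMUs on every vertex of \<open>B\<close> and, if
  \<open>r > 0\<close>, one further PMU on each of \<open>r + j - 1\<close> vertices of \<open>B\<close>. To leave fewer than \<open>j\<close> vertices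
  occupied, one has to clear at least \<open>s - j + 1\<close> vertices of \<open>B\<close>, at least \<open>r\<close> of which carry an extra
  PMU, so at least \<open>q (s - j + 1) + r = k + 1\<close> PMUs have to fail. After \<open>k\<close> failures at least
  \<open>j\<close> vertices of \<open>B\<close> are thus still occupied, and these dominate.
\<close>

lemma filter_repeat_mset: "filter_mset P (repeat_mset n M) = repeat_mset n (filter_mset P M)"
  by (rule multiset_eqI) simp

text \<open>A remaining support \<open>T\<close> of size below \<open>j\<close> misses at least
  \<open>card B + 1 - j\<close> elements of \<open>B\<close> and at least \<open>r\<close> of
  \<open>C\<close>. All their copies would have to lie in \<open>F\<close>, which is too small for
  that.\<close>

lemma card_support_diff_ge:
  assumes "finite B" "finite C" "size F < q * (card B + 1 - j) + r" "j \<le> card B"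
    and "r = 0 \<or> r + j \<le> card C + 1"
  shows "j \<le> card (set_mset (repeat_mset q (mset_set B) + mset_set C - F))"
proof (rule ccontr)
  let ?S = "repeat_mset q (mset_set B) + mset_set C"
  define T where "T = set_mset (?S - F)"
  assume "\<not> ?thesis"
  then have T: "finite T" "card T < j" unfolding T_def by auto
  have "card B + 1 - j \<le> card (B - T)"
    using diff_card_le_card_Diff[OF T(1), of B] T(2) assms(4) by linarith
  moreover have "r \<le> card (C - T)"
    using diff_card_le_card_Diff[OF T(1), of C] T(2) assms(5) by linarith
  ultimately have "q * (card B + 1 - j) + r \<le> q * card (B - T) + card (C - T)"
    by (intro add_mono mult_left_mono) auto
  also have "\<dots> = size (filter_mset (\<lambda>x. x \<notin> T) ?S)"
    using assms(1,2) by (simp add: filter_repeat_mset filter_mset_mset_set set_diff_eq)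
  also have "filter_mset (\<lambda>x. x \<notin> T) ?S \<subseteq># F"
  proof (rule mset_subset_eqI)
    fix x
    show "count (filter_mset (\<lambda>x. x \<notin> T) ?S) x \<le> count F x"
      by (auto simp: T_def in_diff_count not_less)
  qed
  then have "size (filter_mset (\<lambda>x. x \<notin> T) ?S) \<le> size F" by (rule size_mset_mono)
  finally show False using assms(3) by simp
qed

text \<open>Pushing the support below \<open>j\<close> takes at least \<open>k + 1\<close> removals,
  so after \<open>k\<close> of them \<open>j\<close> elements of \<open>B\<close> survive.\<close>

lemma robust_power_dominating_repeat:
  assumes "graph G" "all_subsets_dominating G j B" "C \<subseteq> B" "0 < j" "j \<le> card B"
    and "k + 1 = q * (card B + 1 - j) + r" "r = 0 \<or> r + j \<le> card C + 1"
  shows "robust_power_dominating G k (repeat_mset q (mset_set B) + mset_set C)"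
    (is "robust_power_dominating G k ?S")
proof -
  interpret graph G by fact
  have "B \<subseteq> verts G" using assms(2) unfolding all_subsets_dominating_def by simp
  then have fin: "finite B" "finite C"
    using finite_subset[OF _ finite_verts] assms(3) by blast+
  \<comment> \<open>Only an inclusion: for \<open>q = 0\<close> the vertices of \<open>B\<close>
    outside \<open>C\<close> carry no PMU.\<close>
  have supp: "set_mset ?S \<subseteq> B"
    using fin assms(3) by (auto simp flip: count_greater_zero_iff)
      (auto simp: count_mset_set' split: if_splits)
  have "q * (card B + 1 - j) \<le> q * card B"
    using assms(4) by (intro mult_left_mono) auto
  then have "k + 1 \<le> q * card B + r" using assms(6) by linarith
  then have "k \<le> q * card B + card C" using assms(4,7) by linarith
  then have "k \<le> size ?S" by simp
  moreover have "\<exists>D. D \<subseteq> set_mset (?S - F) \<and> power_dominating G D" if "size F = k" for F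
  proof -
    have "j \<le> card (set_mset (?S - F))"
      using assms(5-7) that by (intro card_support_diff_ge[where r = r] fin) auto
    \<comment> \<open>The property of \<open>B\<close> concerns sets of size exactly
      \<open>j\<close>, so the surviving support is cut down to that size.\<close>
    then obtain D where D: "D \<subseteq> set_mset (?S - F)" "card D = j"
      by (metis obtain_subset_with_card_n)
    moreover have "D \<subseteq> B" using D(1) supp by (meson in_diffD subset_iff)
    ultimately show ?thesis using assms(2) unfolding all_subsets_dominating_def by blast
  qed
  ultimately show ?thesis
    using supp \<open>B \<subseteq> verts G\<close> unfolding robust_power_dominating_def by blast
qed

theorem theorem2:
  fixes G :: "('a, 'b) pre_digraph" and j k q r s :: nat
  defines "s \<equiv> all_subsets_dominating_number G j"
  assumes "graph G" and "verts G \<noteq> {}"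
    and "k \<ge> 1"
    and "s > j" and "j \<ge> power_domination_number G"
    and "k + 1 = q * (s - j + 1) + r" and "r < s - j + 1"
  shows "real (robust_power_domination_number G k) \<le>
    (if r = 0 then real s * (real (k + 1) / real (s - j + 1))
     else real s * of_int \<lfloor>real (k + 1) / real (s - j + 1)\<rfloor> + real r + (real j - 1))"
proof -
  interpret graph G by fact
  have j: "0 < j" using power_domination_number_pos[OF assms(2,3)] assms(6) by simp
  obtain B where B: "all_subsets_dominating G j B" "card B = s"
    using all_subsets_dominating_number_max[OF assms(2) j] unfolding s_def by metis
  define c where "c = (if r = 0 then 0 else r + (j - 1))"
  \<comment> \<open>Since \<open>r\<close> is at most \<open>s - j\<close>, the extra PMUs fit on
    distinct vertices of \<open>B\<close>.\<close>
  have "r + (j - 1) \<le> s" using assms(5,8) by linarith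
  then have "c \<le> card B" unfolding c_def B(2) by simp
  then obtain C where C: "C \<subseteq> B" "card C = c" by (metis obtain_subset_with_card_n)
  have "robust_power_dominating G k (repeat_mset q (mset_set B) + mset_set C)"
  proof (rule robust_power_dominating_repeat[OF assms(2) B(1) C(1) j])
    show "j \<le> card B" using assms(5) B(2) by simp
    have "s - j + 1 = s + 1 - j" using assms(5) by simp
    then show "k + 1 = q * (card B + 1 - j) + r" using assms(7) B(2) by simp
    show "r = 0 \<or> r + j \<le> card C + 1" using C(2) j by (simp add: c_def)
  qed
  then have "robust_power_domination_number G k \<le> q * s + c"
    unfolding robust_power_domination_number_def using B(2) C(2)
    by (intro Least_le exI[of _ "repeat_mset q (mset_set B) + mset_set C"]) simp
  then have bound: "real (robust_power_domination_number G k) \<le> real s * real q + real c"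
    by (metis mult.commute of_nat_add of_nat_le_iff of_nat_mult)
  \<comment> \<open>As \<open>r\<close> is below the divisor, \<open>q\<close> is the integer
    quotient and hence the floor in the bound.\<close>
  have "(k + 1) div (s - j + 1) = q"
    unfolding assms(7) using assms(8) by (subst div_mult_self3) simp_all
  then have fl: "\<lfloor>real (k + 1) / real (s - j + 1)\<rfloor> = int q"
    by (metis floor_divide_of_nat_eq)
  show ?thesis
  proof (cases "r = 0")
    case True
    have "real (k + 1) / real (s - j + 1) = real q"
      unfolding assms(7) True add_0_right of_nat_mult
      by (rule nonzero_mult_div_cancel_right) simp
    with True bound show ?thesis by (simp add: c_def)
  next
    case False
    then have "real c = real r + (real j - 1)" using j by (simp add: c_def of_nat_diff)
    with False bound show ?thesis unfolding fl by simp
  qed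
qed

end
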